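(* Let $\theta^*$ be a minimizer over $\mathbf\Theta$ of $R_{\ell_1}(\theta)=\mathbb{E}_{(\mathbf x,y)\sim\mathbf\Pi}\big[|\mathbf x^T\theta-y|\big]$ and, for $\beta>0$, let $\hat\theta$ be a minimizer over $\mathbf\Theta$ of $$\widehat R_{\varphi,\ell_1}(\theta)=\frac1{n\beta}\sum_{i=1}^n\varphi\big(\beta|y_i-\mathbf x_i^T\theta|\big).$$ Assume: (i) $\mathbf\Theta$ is totally bounded; (ii) $\mathbb{E}_{(\mathbf x,y)\sim\mathbf\Pi}[|\mathbf x|^\alpha]<\infty$; (iii) $\sup_{\theta\in\mathbf\Theta}R_{\ell_\alpha}(\theta)<\infty$, where $R_{\ell_\alpha}(\theta)=\mathbb{E}_{(\mathbf x,y)\sim\mathbf\Pi}[|y-\mathbf x^T\theta|^\alpha]$. Then for any $\delta\in(0,\frac12)$ and any $\varepsilon>0$, with probability at least $1-2\delta$, $$R_{\ell_1}(\hat\theta)-R_{\ell_1}(\theta^* )\le 2\varepsilon\,\mathbb{E}|\mathbf x_1|+\Big(\frac{2^{\alpha-1}\varepsilon^\alpha}{\alpha}\mathbb{E}|\mathbf x_1|^\alpha+\frac{2^{\alpha-1}+1}{\alpha}\sup_{\theta\in\mathbf\Theta}R_{\ell_\alpha}(\theta)\Big)\beta^{\alpha-1}+\frac1{n\beta}\log\frac{N(\mathbf\Theta,\varepsilon)}{\delta^2}.$$ Furthermore, if $\beta=\Big(\frac1n\log\frac{N(\mathbf\Theta,\varepsilon)}{\delta^2}\Big)^{1/\alpha}$,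 then with probability at least $1-2\delta$, $$R_{\ell_1}(\hat\theta)-R_{\ell_1}(\theta^* )\le 2\varepsilon\,\mathbb{E}|\mathbf x_1|+\Big(\frac{2^{\alpha-1}\varepsilon^\alpha}{\alpha}\mathbb{E}|\mathbf x_1|^\alpha+\frac{2^{\alpha-1}+1}{\alpha}\sup_{\theta\in\mathbf\Theta}R_{\ell_\alpha}(\theta)+1\Big)\Big(\frac1n\log\frac{N(\mathbf\Theta,\varepsilon)}{\delta^2}\Big)^{\frac{\alpha-1}{\alpha}}.$$
   Context: Let $\alpha\in(1,2)$, $\mathbf\Theta\subseteq\mathbb{R}^d$ with the Euclidean metric ($|\cdot|$ denotes the Euclidean norm), and let $\mathbf\Pi$ be a probability distribution on $\mathbb{R}^d\times\mathbb{R}$. Let $(\mathbf x_1,y_1),\dots,(\mathbf x_n,y_n)$ be i.i.d. samples from $\mathbf\Pi$. Here $R_{\ell_1}(\hat\theta)$ means the function $R_{\ell_1}$ evaluated at the (sample-dependent) point $\hat\theta$. The minimizers are assumed to exist. Let $\varphi:\mathbb{R}\to\mathbb{R}$ be non-decreasing with $-\log\big(1-x+\frac{|x|^\alpha}{\alpha}\big)\le\varphi(x)\le\log\big(1+x+\frac{|x|^\alpha}{\alpha}\big)$ for all $x\in\mathbb{R}$. An $\varepsilon$-net of $\mathbf\Theta$ is a subset $\mathcal N\subseteq\mathbf\Theta$ such that every $\theta\in\mathbf\Theta$ has some $\tilde\theta\in\mathcal N$ with $|\theta-\tilde\theta|\le\varepsilon$. The covering number $N(\mathbf\Theta,\varepsilon)$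 is the minimal cardinality of an $\varepsilon$-net of $\mathbf\Theta$; $\mathbf\Theta$ is totally bounded if a finite $\varepsilon$-net exists for every $\varepsilon>0$. *)

theory Defs
  imports "HOL-Probability.Probability"
begin

text \<open>The law of a pair \<open>(x, y)\<close> is a measure \<open>P\<close> on \<open>(real ^ 'd) \<times> real\<close>. Both risks are
  Bochner integrals, hence meaningful only for those \<open>\<theta>\<close> at which the loss is integrable.\<close>

definition risk_l1 :: "((real ^ 'd) \<times> real) measure \<Rightarrow> real ^ 'd \<Rightarrow> real" where
  "risk_l1 P \<theta> = (\<integral>(x, y). \<bar>x \<bullet> \<theta> - y\<bar> \<partial>P)"

definition risk_lpow :: "((real ^ 'd) \<times> real) measure \<Rightarrow> real \<Rightarrow> real ^ 'd \<Rightarrow> real" where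
  "risk_lpow P \<alpha> \<theta> = (\<integral>(x, y). \<bar>y - x \<bullet> \<theta>\<bar> powr \<alpha> \<partial>P)"

definition emp_risk ::
  "(real \<Rightarrow> real) \<Rightarrow> real \<Rightarrow> nat \<Rightarrow> (nat \<Rightarrow> real ^ 'd) \<Rightarrow> (nat \<Rightarrow> real) \<Rightarrow> real ^ 'd \<Rightarrow> real" where
  "emp_risk \<phi> \<beta> n x y \<theta> = 1 / (real n * \<beta>) * (\<Sum>i=1..n. \<phi> (\<beta> * \<bar>y i - x i \<bullet> \<theta>\<bar>))"

definition eps_net :: "'a::metric_space set \<Rightarrow> real \<Rightarrow> 'a set \<Rightarrow> bool" where
  "eps_net T \<epsilon> N \<longleftrightarrow> N \<subseteq> T \<and> (\<forall>\<theta>\<in>T. \<exists>\<theta>'\<in>N. dist \<theta> \<theta>' \<le> \<epsilon>)"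

text \<open>Only finite nets are counted, since \<open>card\<close> of an infinite set is \<open>0\<close>. For totally bounded
  \<open>T\<close> and \<open>\<epsilon> > 0\<close> a finite net exists, so the minimum is attained.\<close>

definition covering_number :: "'a::metric_space set \<Rightarrow> real \<Rightarrow> nat" where
  "covering_number T \<epsilon> = (LEAST k. \<exists>N. finite N \<and> eps_net T \<epsilon> N \<and> card N = k)"

text \<open>The library's \<open>totally_bounded\<close> does not ask for the centres to lie in the set; it is
  nevertheless equivalent to the existence of finite (internal) \<open>\<epsilon>\<close>-nets.\<close>

lemma totally_bounded_iff_eps_net:
  fixes T :: "'a::metric_space set"
  shows "totally_bounded T \<longleftrightarrow> (\<forall>\<epsilon>>0. \<exists>N. finite N \<and> eps_net T \<epsilon> N)"
proof
  assume tb: "totally_bounded T"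
  show "\<forall>\<epsilon>>0. \<exists>N. finite N \<and> eps_net T \<epsilon> N"
  proof (intro allI impI)
    fix \<epsilon> :: real assume e: "\<epsilon> > 0"
    have "\<epsilon> / 2 > 0" using e by simp
    then obtain X where X: "finite X" "T \<subseteq> (\<Union>x\<in>X. {y. dist x y < \<epsilon> / 2})"
      using tb unfolding totally_bounded_metric by blast
    define c where "c x = (SOME s. s \<in> T \<and> dist x s < \<epsilon> / 2)" for x
    define N where "N = c ` {x \<in> X. \<exists>s\<in>T. dist x s < \<epsilon> / 2}"
    have c: "c x \<in> T \<and> dist x (c x) < \<epsilon> / 2" if "\<exists>s\<in>T. dist x s < \<epsilon> / 2" for x
      unfolding c_def using that someI_ex[of "\<lambda>s. s \<in> T \<and> dist x s < \<epsilon> / 2"] by blast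
    have "\<exists>t\<in>N. dist s t \<le> \<epsilon>" if "s \<in> T" for s
    proof -
      obtain x where x: "x \<in> X" "dist x s < \<epsilon> / 2" using X(2) \<open>s \<in> T\<close> by blast
      have "dist x (c x) < \<epsilon> / 2" using c x that by blast
      then have "dist s (c x) \<le> \<epsilon>"
        using dist_triangle[of s "c x" x] x(2) by (simp add: dist_commute)
      moreover have "c x \<in> N" using x that by (auto simp: N_def)
      ultimately show ?thesis by blast
    qed
    moreover have "N \<subseteq> T" using c by (auto simp: N_def)
    ultimately show "\<exists>N. finite N \<and> eps_net T \<epsilon> N"
      using X(1) by (intro exI[of _ N]) (simp add: eps_net_def N_def)
  qed
next
  assume net: "\<forall>\<epsilon>>0. \<exists>N. finite N \<and> eps_net T \<epsilon> N"
  show "totally_bounded T"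
    unfolding totally_bounded_metric
  proof (intro allI impI)
    fix e :: real assume e: "e > 0"
    then have "e / 2 > 0" by simp
    then obtain N where N: "finite N" "eps_net T (e / 2) N" using net by blast
    have "\<exists>x\<in>N. dist x s < e" if s: "s \<in> T" for s
    proof -
      obtain x where x: "x \<in> N" "dist s x \<le> e / 2" using N(2) s unfolding eps_net_def by blast
      then have "dist x s < e" using e by (simp add: dist_commute)
      then show ?thesis using x(1) by blast
    qed
    then have "T \<subseteq> (\<Union>x\<in>N. {y. dist x y < e})" by blast
    with N(1) show "\<exists>k. finite k \<and> T \<subseteq> (\<Union>x\<in>k. {y. dist x y < e})" by blast
  qed
qed

text \<open>The property \<open>Q\<close> below involves an arbitrary, possibly non-measurable, selection of
  minimizers. It is therefore required to hold on some event of probability at least \<open>p\<close>; by the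
  lemma that follows this is the usual meaning whenever \<open>Q\<close> is itself an event.\<close>

definition with_prob_at_least :: "'w measure \<Rightarrow> real \<Rightarrow> ('w \<Rightarrow> bool) \<Rightarrow> bool" where
  "with_prob_at_least M p Q \<longleftrightarrow> (\<exists>A\<in>sets M. p \<le> measure M A \<and> (\<forall>\<omega>\<in>A. Q \<omega>))"

lemma (in prob_space) with_prob_at_least_iff:
  assumes "{\<omega> \<in> space M. Q \<omega>} \<in> sets M"
  shows "with_prob_at_least M p Q \<longleftrightarrow> p \<le> \<P>(\<omega> in M. Q \<omega>)"
proof
  assume "with_prob_at_least M p Q"
  then obtain A where A: "A \<in> sets M" "p \<le> prob A" "\<forall>\<omega>\<in>A. Q \<omega>"
    unfolding with_prob_at_least_def by blast
  have "A \<subseteq> {\<omega> \<in> space M. Q \<omega>}" using A sets.sets_into_space by blast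
  then have "prob A \<le> prob {\<omega> \<in> space M. Q \<omega>}" using assms by (rule finite_measure_mono)
  with A(2) show "p \<le> \<P>(\<omega> in M. Q \<omega>)" by simp
next
  assume "p \<le> \<P>(\<omega> in M. Q \<omega>)"
  with assms show "with_prob_at_least M p Q"
    unfolding with_prob_at_least_def by (intro bexI[of _ "{\<omega> \<in> space M. Q \<omega>}"]) auto
qed

end

theory Submission
  imports Defs
begin

text \<open>
  Replacing the loss by its image under \<open>\<phi>\<close> makes the empirical risk concentrate although only a
  moment of order \<open>\<alpha> < 2\<close> of the loss is assumed to be finite. The upper bound on \<open>\<phi>\<close> says
  \<open>exp (\<phi> z) \<le> 1 + z + \<bar>z\<bar> powr \<alpha> / \<alpha>\<close>, so by
  independence the exponential moment of \<open>\<Sum>i. \<phi> (\<beta> * f W\<^sub>i)\<close> is at most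
  \<open>exp (n * (\<beta> * E f + \<beta> powr \<alpha> / \<alpha> * E (\<bar>f\<bar> powr \<alpha>)))\<close>: a Chernoff bound with exponential decay, at the
  price of a bias of order \<open>\<beta> powr (\<alpha> - 1)\<close> (\<open>influence_sum_deviation\<close>). The hypothesis on \<open>\<phi>\<close> is
  invariant under \<open>\<phi> \<mapsto> (\<lambda>z. - \<phi> (- z))\<close>, which turns this upper deviation bound into a lower one.

  The upper bound is needed at the single point \<open>\<theta>_star\<close> only. The lower bound is needed at the
  random point \<open>\<theta>_hat\<close>, hence uniformly over \<open>\<Theta>\<close>. If \<open>\<theta>'\<close> lies within \<open>\<epsilon>\<close> of \<open>\<theta>\<close>, then
  \<open>\<bar>y - x \<bullet> \<theta>\<bar> \<ge> \<bar>y - x \<bullet> \<theta>'\<bar> - \<epsilon> * norm x\<close>, and monotonicity of \<open>\<phi>\<close> carries this over to the empirical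
  risk (\<open>influence_sum_net_le\<close>). It therefore suffices to bound the right-hand side from below at
  the \<open>N\<close> points \<open>\<theta>'\<close> of a minimal \<open>\<epsilon>\<close>-net, with failure probability \<open>\<delta> / N\<close> at each. The shifted
  loss can be negative, which is why \<open>\<phi>\<close> has to be controlled on the whole line. The passage to the
  net costs \<open>\<epsilon> * E (norm x)\<close> twice: once in the shift, once in comparing the risks at \<open>\<theta>'\<close> and \<open>\<theta>_hat\<close>.
  The two logarithms \<open>ln (1 / \<delta>)\<close> and \<open>ln (N / \<delta>)\<close> add up to
  \<open>ln (N / \<delta>\<^sup>2)\<close>. The special \<open>\<beta>\<close> of the second claim makes \<open>\<beta> powr (\<alpha> - 1)\<close> equal to the
  logarithmic term divided by \<open>n * \<beta>\<close>.
\<close>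

section \<open>Elementary inequalities\<close>

text \<open>Young's inequality for \<open>\<bar>z\<bar> * 1\<close> leaves the slack \<open>1 / \<alpha>\<close>. Positivity is what allows the
  bounds on \<open>\<phi>\<close> to be exponentiated.\<close>

lemma one_plus_powr_pos:
  fixes \<alpha> z :: real
  assumes "1 < \<alpha>"
  shows "0 < 1 + z + \<bar>z\<bar> powr \<alpha> / \<alpha>"
proof -
  have "1 / \<alpha> + 1 / (\<alpha> / (\<alpha> - 1)) = 1" "1 < \<alpha> / (\<alpha> - 1)"
    using assms by (auto simp: field_simps)
  then have "\<bar>z\<bar> * 1 \<le> \<bar>z\<bar> powr \<alpha> / \<alpha> + 1 powr (\<alpha> / (\<alpha> - 1)) / (\<alpha> / (\<alpha> - 1))"
    using assms by (intro Youngs_inequality) auto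
  moreover have "1 powr (\<alpha> / (\<alpha> - 1)) / (\<alpha> / (\<alpha> - 1)) < 1"
    using assms by (simp add: field_simps)
  ultimately show ?thesis by linarith
qed

text \<open>The difference of two nonnegative numbers is at most the larger one. The factor, which is at
  least \<open>1\<close>, is the convexity constant that appears in the excess risk bound.\<close>

lemma powr_abs_diff_le:
  fixes a b \<alpha> :: real
  assumes "1 \<le> \<alpha>" "0 \<le> a" "0 \<le> b"
  shows "\<bar>a - b\<bar> powr \<alpha> \<le> 2 powr (\<alpha> - 1) * (a powr \<alpha> + b powr \<alpha>)"
proof -
  have "\<bar>a - b\<bar> powr \<alpha> \<le> max a b powr \<alpha>"
    using assms by (intro powr_mono2) auto
  also have "\<dots> \<le> 1 * (a powr \<alpha> + b powr \<alpha>)"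
    by (simp add: max_def)
  also have "\<dots> \<le> 2 powr (\<alpha> - 1) * (a powr \<alpha> + b powr \<alpha>)"
    using assms by (intro mult_right_mono ge_one_powr_ge_zero) auto
  finally show ?thesis .
qed

lemma (in finite_measure) integrable_of_integrable_powr:
  fixes f :: "'a \<Rightarrow> real"
  assumes [measurable]: "f \<in> borel_measurable M"
    and "1 \<le> \<alpha>" "integrable M (\<lambda>z. \<bar>f z\<bar> powr \<alpha>)"
  shows "integrable M f"
proof (rule Bochner_Integration.integrable_bound)
  show "integrable M (\<lambda>z. 1 + \<bar>f z\<bar> powr \<alpha>)"
    using assms(3) by simp
  have "\<bar>t\<bar> \<le> 1 + \<bar>t\<bar> powr \<alpha>" for t :: real
  proof (cases "\<bar>t\<bar> \<le> 1")
    case True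
    then show ?thesis by (simp add: add_increasing2)
  next
    case False
    then have "\<bar>t\<bar> powr 1 \<le> \<bar>t\<bar> powr \<alpha>"
      using assms(2) by (intro powr_mono) auto
    with False show ?thesis by simp
  qed
  then show "AE z in M. norm (f z) \<le> norm (1 + \<bar>f z\<bar> powr \<alpha>)"
    by (intro AE_I2) (simp add: add_nonneg_nonneg)
qed simp

section \<open>Deviation of a sum of influence values\<close>

text \<open>The Chernoff bound at parameter \<open>1\<close>: the exponential moment is a product by independence, and
  \<open>1 + t \<le> exp t\<close> returns it to exponential form.\<close>

lemma (in prob_space) iid_chernoff_le:
  fixes W :: "nat \<Rightarrow> 'a \<Rightarrow> 'b::topological_space" and P :: "'b measure" and h g :: "'b \<Rightarrow> real"
  assumes indep: "indep_vars (\<lambda>_. borel) W {1..n}"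
    and law: "\<And>i. i \<in> {1..n} \<Longrightarrow> distr M borel (W i) = P"
    and P: "prob_space P" "sets P = sets borel"
    and h: "h \<in> borel_measurable borel"
    and g: "integrable P g"
    and le: "\<And>w. exp (h w) \<le> 1 + g w"
    and \<eta>: "0 < \<eta>"
  shows "prob {\<omega> \<in> space M. real n * (\<integral>w. g w \<partial>P) + ln (1 / \<eta>) \<le> (\<Sum>i=1..n. h (W i \<omega>))} \<le> \<eta>"
proof -
  interpret P: prob_space P by fact
  have W [measurable]: "random_variable borel (W i)" if "i \<in> {1..n}" for i
    using indep that by (auto simp: indep_vars_def)
  have hP: "h \<in> borel_measurable P"
    using h measurable_cong_sets[OF P(2) refl] by blast
  have exp_int: "integrable P (\<lambda>w. exp (h w))"
  proof (rule Bochner_Integration.integrable_bound)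
    show "integrable P (\<lambda>w. 1 + g w)" using g by simp
    show "(\<lambda>w. exp (h w)) \<in> borel_measurable P" using hP by simp
    show "AE w in P. norm (exp (h w)) \<le> norm (1 + g w)"
      by (intro AE_I2) (use le in \<open>auto intro: order_trans[OF _ abs_ge_self]\<close>)
  qed
  have ind: "indep_vars (\<lambda>_. borel) (\<lambda>i \<omega>. exp (h (W i \<omega>))) {1..n}"
    using indep by (rule indep_vars_compose2) (use h in simp)
  have int_i: "integrable M (\<lambda>\<omega>. exp (h (W i \<omega>)))" if i: "i \<in> {1..n}" for i
    using exp_int h law[OF i] integrable_distr[OF W[OF i], of "\<lambda>w. exp (h w)"] by simp
  have E_i: "(\<integral>\<omega>. exp (h (W i \<omega>)) \<partial>M) = (\<integral>w. exp (h w) \<partial>P)" if i: "i \<in> {1..n}" for i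
    using h law[OF i] integral_distr[OF W[OF i], of "\<lambda>w. exp (h w)"] by simp
  define s where "s = real n * (\<integral>w. g w \<partial>P)"
  have int: "integrable M (\<lambda>\<omega>. \<Prod>i\<in>{1..n}. exp (h (W i \<omega>)))"
    by (rule indep_vars_integrable[OF _ ind int_i]) auto
  have "(\<integral>\<omega>. (\<Prod>i\<in>{1..n}. exp (h (W i \<omega>))) \<partial>M) = (\<integral>w. exp (h w) \<partial>P) ^ n"
    by (subst indep_vars_lebesgue_integral[OF _ ind int_i]) (auto simp: E_i)
  also have "\<dots> \<le> exp (\<integral>w. g w \<partial>P) ^ n"
  proof (rule power_mono)
    have "(\<integral>w. exp (h w) \<partial>P) \<le> (\<integral>w. 1 + g w \<partial>P)"
      using exp_int g le by (intro integral_mono) auto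
    also have "\<dots> = 1 + (\<integral>w. g w \<partial>P)"
      using g by (simp add: P.prob_space)
    finally show "(\<integral>w. exp (h w) \<partial>P) \<le> exp (\<integral>w. g w \<partial>P)"
      using exp_ge_add_one_self order_trans by blast
  qed simp
  also have "\<dots> = exp s"
    by (simp add: s_def exp_of_nat_mult)
  finally have moment: "(\<integral>\<omega>. exp (\<Sum>i=1..n. h (W i \<omega>)) \<partial>M) \<le> exp s"
    by (simp add: exp_sum)
  have exp_le: "s + ln (1 / \<eta>) \<le> t \<longleftrightarrow> exp s / \<eta> \<le> exp t" for t
  proof -
    have "exp s / \<eta> = exp (s + ln (1 / \<eta>))"
      using \<eta> by (simp add: exp_add)
    then show ?thesis by simp
  qed
  have "prob {\<omega> \<in> space M. s + ln (1 / \<eta>) \<le> (\<Sum>i=1..n. h (W i \<omega>))}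
      = prob {\<omega> \<in> space M. exp s / \<eta> \<le> exp (\<Sum>i=1..n. h (W i \<omega>))}"
    by (simp add: exp_le)
  also have "\<dots> \<le> (\<integral>\<omega>. exp (\<Sum>i=1..n. h (W i \<omega>)) \<partial>M) / (exp s / \<eta>)"
    using int \<eta> by (intro integral_Markov_inequality_measure[of _ _ "{}"])
      (auto simp: exp_sum intro!: prod_nonneg)
  also have "\<dots> \<le> exp s / (exp s / \<eta>)"
    using moment \<eta> by (intro divide_right_mono) auto
  also have "\<dots> = \<eta>"
    by simp
  finally show ?thesis
    by (simp add: s_def)
qed

text \<open>Since \<open>exp (\<psi> (\<beta> * f)) \<le> 1 + \<beta> * f + \<beta> powr \<alpha> / \<alpha> * \<bar>f\<bar> powr \<alpha>\<close>, the logarithm of the exponential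
  moment is controlled by moments of \<open>f\<close> of order at most \<open>\<alpha>\<close>. Lower deviations of the sum for an
  influence function \<open>\<phi>\<close> are the case of \<open>- f\<close> and \<open>\<psi> = (\<lambda>z. - \<phi> (- z))\<close>.\<close>

lemma (in prob_space) influence_sum_deviation:
  fixes W :: "nat \<Rightarrow> 'a \<Rightarrow> 'b::topological_space" and P :: "'b measure" and f :: "'b \<Rightarrow> real"
  assumes indep: "indep_vars (\<lambda>_. borel) W {1..n}"
    and law: "\<And>i. i \<in> {1..n} \<Longrightarrow> distr M borel (W i) = P"
    and P: "prob_space P" "sets P = sets borel"
    and \<psi>: "\<psi> \<in> borel_measurable borel" "\<And>z. \<psi> z \<le> ln (1 + z + \<bar>z\<bar> powr \<alpha> / \<alpha>)"
    and f: "f \<in> borel_measurable borel" "integrable P (\<lambda>w. \<bar>f w\<bar> powr \<alpha>)"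
    and pos: "1 < \<alpha>" "0 < \<beta>" "0 < \<eta>"
  shows "prob {\<omega> \<in> space M.
      real n * (\<beta> * (\<integral>w. f w \<partial>P) + \<beta> powr \<alpha> / \<alpha> * (\<integral>w. \<bar>f w\<bar> powr \<alpha> \<partial>P)) + ln (1 / \<eta>)
        \<le> (\<Sum>i=1..n. \<psi> (\<beta> * f (W i \<omega>)))} \<le> \<eta>"
proof -
  interpret P: prob_space P by fact
  have fP: "f \<in> borel_measurable P"
    using f(1) measurable_cong_sets[OF P(2) refl] by blast
  have intf: "integrable P f"
    by (rule P.integrable_of_integrable_powr[of f \<alpha>]) (use fP f(2) pos(1) in auto)
  define g where "g w = \<beta> * f w + \<beta> powr \<alpha> / \<alpha> * \<bar>f w\<bar> powr \<alpha>" for w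
  have g: "integrable P g"
    unfolding g_def using intf f(2) by simp
  have "exp (\<psi> (\<beta> * f w)) \<le> 1 + g w" for w
  proof -
    have "exp (\<psi> (\<beta> * f w)) \<le> exp (ln (1 + \<beta> * f w + \<bar>\<beta> * f w\<bar> powr \<alpha> / \<alpha>))"
      using \<psi>(2) by simp
    also have "\<dots> = 1 + \<beta> * f w + \<bar>\<beta> * f w\<bar> powr \<alpha> / \<alpha>"
      using one_plus_powr_pos[OF pos(1)] by simp
    also have "\<dots> = 1 + g w"
      using pos by (simp add: g_def abs_mult powr_mult)
    finally show ?thesis .
  qed
  from iid_chernoff_le[OF indep law P _ g this pos(3)] \<psi>(1) f(1)
  have "prob {\<omega> \<in> space M. real n * (\<integral>w. g w \<partial>P) + ln (1 / \<eta>)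
      \<le> (\<Sum>i=1..n. \<psi> (\<beta> * f (W i \<omega>)))} \<le> \<eta>"
    by simp
  moreover have "(\<integral>w. g w \<partial>P) = \<beta> * (\<integral>w. f w \<partial>P) + \<beta> powr \<alpha> / \<alpha> * (\<integral>w. \<bar>f w\<bar> powr \<alpha> \<partial>P)"
    unfolding g_def using intf f(2) by simp
  ultimately show ?thesis by simp
qed

section \<open>Nets and the empirical risk\<close>

lemma abs_residual_diff_le:
  fixes x \<theta> \<theta>' :: "'a::real_inner"
  assumes "dist \<theta> \<theta>' \<le> \<epsilon>"
  shows "\<bar>\<bar>y - x \<bullet> \<theta>'\<bar> - \<bar>y - x \<bullet> \<theta>\<bar>\<bar> \<le> \<epsilon> * norm x"
proof -
  have "\<bar>\<bar>y - x \<bullet> \<theta>'\<bar> - \<bar>y - x \<bullet> \<theta>\<bar>\<bar> \<le> \<bar>x \<bullet> (\<theta> - \<theta>')\<bar>"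
    by (simp add: inner_diff_right)
  also have "\<dots> \<le> norm x * norm (\<theta> - \<theta>')"
    by (rule Cauchy_Schwarz_ineq2)
  also have "\<dots> \<le> norm x * \<epsilon>"
    using assms by (intro mult_left_mono) (auto simp: dist_norm)
  finally show ?thesis by (simp add: mult.commute)
qed

text \<open>The left-hand side depends on \<open>\<theta>\<close> through the net point only, so finitely many
  sums control the empirical risk on the whole of a totally bounded set.\<close>

lemma influence_sum_net_le:
  fixes x :: "'i \<Rightarrow> 'a::real_inner" and \<phi> :: "real \<Rightarrow> real"
  assumes "mono \<phi>" "0 \<le> \<beta>" "dist \<theta> \<theta>' \<le> \<epsilon>"
  shows "(\<Sum>i\<in>I. \<phi> (\<beta> * (\<bar>y i - x i \<bullet> \<theta>'\<bar> - \<epsilon> * norm (x i)))) \<le> (\<Sum>i\<in>I. \<phi> (\<beta> * \<bar>y i - x i \<bullet> \<theta>\<bar>))"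
proof (rule sum_mono, rule monoD[OF assms(1)], rule mult_left_mono[OF _ assms(2)])
  fix i
  show "\<bar>y i - x i \<bullet> \<theta>'\<bar> - \<epsilon> * norm (x i) \<le> \<bar>y i - x i \<bullet> \<theta>\<bar>"
    using abs_residual_diff_le[OF assms(3), of "y i" "x i"] by linarith
qed

lemma minimal_eps_net:
  assumes "totally_bounded T" "0 < \<epsilon>"
  obtains N where "finite N" "eps_net T \<epsilon> N" "card N = covering_number T \<epsilon>"
proof -
  have "\<exists>k N. finite N \<and> eps_net T \<epsilon> N \<and> card N = k"
    using assms totally_bounded_iff_eps_net by metis
  then have "\<exists>N. finite N \<and> eps_net T \<epsilon> N \<and> card N = covering_number T \<epsilon>"
    unfolding covering_number_def by (rule LeastI_ex)
  then show ?thesis using that by blast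
qed

section \<open>The choice of the scale\<close>

text \<open>With \<open>\<beta> powr \<alpha> = c\<close> the bias \<open>\<beta> powr (\<alpha> - 1)\<close> and the stochastic term \<open>c / \<beta>\<close> coincide.\<close>

lemma balanced_scale:
  fixes \<alpha> c :: real
  assumes "0 < \<alpha>" "0 < c"
  shows "(c powr (1 / \<alpha>)) powr (\<alpha> - 1) = c powr ((\<alpha> - 1) / \<alpha>)"
    and "c / c powr (1 / \<alpha>) = c powr ((\<alpha> - 1) / \<alpha>)"
proof -
  show "(c powr (1 / \<alpha>)) powr (\<alpha> - 1) = c powr ((\<alpha> - 1) / \<alpha>)"
    by (simp add: powr_powr)
  have "c / c powr (1 / \<alpha>) = c powr (1 - 1 / \<alpha>)"
    using assms by (simp add: powr_diff)
  then show "c / c powr (1 / \<alpha>) = c powr ((\<alpha> - 1) / \<alpha>)"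
    using assms by (simp add: diff_divide_distrib)
qed

section \<open>The excess risk bounds\<close>

theorem theorem4p2:
  fixes \<alpha> \<beta> \<delta> \<epsilon> :: real and n :: nat
    and \<Theta> :: "(real ^ 'd) set"
    and P :: "((real ^ 'd) \<times> real) measure"
    and M :: "'w measure"
    and X :: "nat \<Rightarrow> 'w \<Rightarrow> real ^ 'd" and Y :: "nat \<Rightarrow> 'w \<Rightarrow> real"
    and \<phi> :: "real \<Rightarrow> real"
    and \<theta>_star :: "real ^ 'd" and \<theta>_hat :: "'w \<Rightarrow> real ^ 'd"
  assumes alpha: "1 < \<alpha>" "\<alpha> < 2"
    and n: "1 \<le> n"
    and P: "prob_space P" "sets P = sets borel"
    and M: "prob_space M"
    and indep: "prob_space.indep_vars M (\<lambda>_. borel) (\<lambda>i \<omega>. (X i \<omega>, Y i \<omega>)) {1..n}"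
    and law: "\<And>i. i \<in> {1..n} \<Longrightarrow> distr M borel (\<lambda>\<omega>. (X i \<omega>, Y i \<omega>)) = P"
    and phi_mono: "mono \<phi>"
    and phi_bounds: "\<And>x. - ln (1 - x + \<bar>x\<bar> powr \<alpha> / \<alpha>) \<le> \<phi> x"
      "\<And>x. \<phi> x \<le> ln (1 + x + \<bar>x\<bar> powr \<alpha> / \<alpha>)"
    and theta_star: "is_arg_min (risk_l1 P) (\<lambda>\<theta>. \<theta> \<in> \<Theta>) \<theta>_star"
    and beta: "0 < \<beta>"
    and theta_hat: "\<And>\<omega>. \<omega> \<in> space M \<Longrightarrow>
      is_arg_min (emp_risk \<phi> \<beta> n (\<lambda>i. X i \<omega>) (\<lambda>i. Y i \<omega>)) (\<lambda>\<theta>. \<theta> \<in> \<Theta>) (\<theta>_hat \<omega>)"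
    and tot_bdd: "totally_bounded \<Theta>"
    and x_moment: "integrable P (\<lambda>(x, y). norm x powr \<alpha>)"
    and risk_integrable: "\<And>\<theta>. \<theta> \<in> \<Theta> \<Longrightarrow> integrable P (\<lambda>(x, y). \<bar>y - x \<bullet> \<theta>\<bar> powr \<alpha>)"
    and risk_sup: "bdd_above (risk_lpow P \<alpha> ` \<Theta>)"
    and delta: "0 < \<delta>" "\<delta> < 1 / 2"
    and eps: "0 < \<epsilon>"
  shows "with_prob_at_least M (1 - 2 * \<delta>) (\<lambda>\<omega>.
        risk_l1 P (\<theta>_hat \<omega>) - risk_l1 P \<theta>_star
          \<le> 2 * \<epsilon> * (\<integral>\<omega>'. norm (X 1 \<omega>') \<partial>M)
            + (2 powr (\<alpha> - 1) * \<epsilon> powr \<alpha> / \<alpha> * (\<integral>\<omega>'. norm (X 1 \<omega>') powr \<alpha> \<partial>M)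
               + (2 powr (\<alpha> - 1) + 1) / \<alpha> * (SUP \<theta>\<in>\<Theta>. risk_lpow P \<alpha> \<theta>)) * \<beta> powr (\<alpha> - 1)
            + 1 / (real n * \<beta>) * ln (real (covering_number \<Theta> \<epsilon>) / \<delta>\<^sup>2))
    \<and> (\<beta> = (1 / real n * ln (real (covering_number \<Theta> \<epsilon>) / \<delta>\<^sup>2)) powr (1 / \<alpha>) \<longrightarrow>
      with_prob_at_least M (1 - 2 * \<delta>) (\<lambda>\<omega>.
        risk_l1 P (\<theta>_hat \<omega>) - risk_l1 P \<theta>_star
          \<le> 2 * \<epsilon> * (\<integral>\<omega>'. norm (X 1 \<omega>') \<partial>M)
            + (2 powr (\<alpha> - 1) * \<epsilon> powr \<alpha> / \<alpha> * (\<integral>\<omega>'. norm (X 1 \<omega>') powr \<alpha> \<partial>M)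
               + (2 powr (\<alpha> - 1) + 1) / \<alpha> * (SUP \<theta>\<in>\<Theta>. risk_lpow P \<alpha> \<theta>) + 1)
              * (1 / real n * ln (real (covering_number \<Theta> \<epsilon>) / \<delta>\<^sup>2)) powr ((\<alpha> - 1) / \<alpha>)))"
proof -
  interpret M: prob_space M by fact
  interpret P: prob_space P by fact
  define W where "W i \<omega> = (X i \<omega>, Y i \<omega>)" for i \<omega>
  note indep' = indep[folded W_def] and law' = law[folded W_def]
  have W1 [measurable]: "W 1 \<in> borel_measurable M"
    using indep' n by (auto simp: M.indep_vars_def)
  have PM: "f \<in> borel_measurable P" if "f \<in> borel_measurable borel" for f :: "_ \<Rightarrow> real"
    using that measurable_cong_sets[OF P(2) refl] by blast

  \<comment> \<open>\<open>u \<theta>\<close> is a common minorant of the losses \<open>r \<theta>'\<close> over all \<open>\<theta>'\<close> within \<open>\<epsilon>\<close> of \<open>\<theta>\<close>.\<close>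
  define r where "r \<theta> w = \<bar>snd w - fst w \<bullet> \<theta>\<bar>" for \<theta> and w :: "(real ^ 'd) \<times> real"
  define u where "u \<theta> w = r \<theta> w - \<epsilon> * norm (fst w)" for \<theta> and w :: "(real ^ 'd) \<times> real"
  have r_meas: "r \<theta> \<in> borel_measurable borel" for \<theta>
    unfolding r_def by (intro borel_measurable_continuous_onI continuous_intros)
  have nx_meas: "(\<lambda>w. norm (fst w)) \<in> borel_measurable (borel :: ((real ^ 'd) \<times> real) measure)"
    by (intro borel_measurable_continuous_onI continuous_intros)
  have u_meas: "u \<theta> \<in> borel_measurable borel" for \<theta>
    unfolding u_def using r_meas nx_meas by simp
  have nx_pow: "integrable P (\<lambda>w. norm (fst w) powr \<alpha>)"
    using x_moment by (simp add: case_prod_unfold)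
  have nx_int: "integrable P (\<lambda>w. norm (fst w))"
    by (rule P.integrable_of_integrable_powr[of _ \<alpha>]) (use alpha nx_pow PM[OF nx_meas] in auto)
  have r_pow: "integrable P (\<lambda>w. r \<theta> w powr \<alpha>)" if "\<theta> \<in> \<Theta>" for \<theta>
    using risk_integrable[OF that] by (simp add: case_prod_unfold r_def)
  have r_nonneg: "0 \<le> r \<theta> w" for \<theta> w
    by (simp add: r_def)
  have r_int: "integrable P (r \<theta>)" if "\<theta> \<in> \<Theta>" for \<theta>
    by (rule P.integrable_of_integrable_powr[of _ \<alpha>])
      (use alpha r_pow[OF that] PM[OF r_meas] r_nonneg in auto)
  have risk1: "risk_l1 P \<theta> = (\<integral>w. r \<theta> w \<partial>P)" for \<theta>
    by (simp add: risk_l1_def r_def case_prod_unfold abs_minus_commute)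
  have riska: "risk_lpow P \<alpha> \<theta> = (\<integral>w. r \<theta> w powr \<alpha> \<partial>P)" for \<theta>
    by (simp add: risk_lpow_def r_def case_prod_unfold)

  define Ex where "Ex = (\<integral>w. norm (fst w) \<partial>P)"
  define Exa where "Exa = (\<integral>w. norm (fst w) powr \<alpha> \<partial>P)"
  define S where "S = (SUP \<theta>\<in>\<Theta>. risk_lpow P \<alpha> \<theta>)"
  have PW: "P = distr M borel (W 1)"
    using law' n by simp
  have Ex_M: "(\<integral>\<omega>'. norm (X 1 \<omega>') \<partial>M) = Ex"
    unfolding Ex_def PW by (subst integral_distr[OF W1 nx_meas]) (simp add: W_def)
  have "(\<lambda>w. norm (fst w) powr \<alpha>) \<in> borel_measurable (borel :: ((real ^ 'd) \<times> real) measure)"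
    using nx_meas by simp
  then have Exa_M: "(\<integral>\<omega>'. norm (X 1 \<omega>') powr \<alpha> \<partial>M) = Exa"
    unfolding Exa_def PW by (subst integral_distr[OF W1]) (simp_all add: W_def)
  have le_S: "risk_lpow P \<alpha> \<theta> \<le> S" if "\<theta> \<in> \<Theta>" for \<theta>
    unfolding S_def using risk_sup that by (intro cSUP_upper) auto

  have u_pow_le: "\<bar>u \<theta> w\<bar> powr \<alpha> \<le> 2 powr (\<alpha> - 1) * (r \<theta> w powr \<alpha> + \<epsilon> powr \<alpha> * norm (fst w) powr \<alpha>)"
    for \<theta> w
    using powr_abs_diff_le[of \<alpha> "r \<theta> w" "\<epsilon> * norm (fst w)"] alpha eps
    by (simp add: u_def r_nonneg powr_mult)
  have u_pow: "integrable P (\<lambda>w. \<bar>u \<theta> w\<bar> powr \<alpha>)" if "\<theta> \<in> \<Theta>" for \<theta>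
  proof (rule Bochner_Integration.integrable_bound)
    show "integrable P (\<lambda>w. 2 powr (\<alpha> - 1) * (r \<theta> w powr \<alpha> + \<epsilon> powr \<alpha> * norm (fst w) powr \<alpha>))"
      using r_pow[OF that] nx_pow by simp
    show "(\<lambda>w. \<bar>u \<theta> w\<bar> powr \<alpha>) \<in> borel_measurable P"
      using PM[OF u_meas] by simp
    show "AE w in P. norm (\<bar>u \<theta> w\<bar> powr \<alpha>)
        \<le> norm (2 powr (\<alpha> - 1) * (r \<theta> w powr \<alpha> + \<epsilon> powr \<alpha> * norm (fst w) powr \<alpha>))"
      by (intro AE_I2) (use u_pow_le in \<open>auto intro: order_trans[OF _ abs_ge_self]\<close>)
  qed
  have u_pow_int: "(\<integral>w. \<bar>u \<theta> w\<bar> powr \<alpha> \<partial>P) \<le> 2 powr (\<alpha> - 1) * (S + \<epsilon> powr \<alpha> * Exa)"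
    if "\<theta> \<in> \<Theta>" for \<theta>
  proof -
    have "(\<integral>w. \<bar>u \<theta> w\<bar> powr \<alpha> \<partial>P)
        \<le> (\<integral>w. 2 powr (\<alpha> - 1) * (r \<theta> w powr \<alpha> + \<epsilon> powr \<alpha> * norm (fst w) powr \<alpha>) \<partial>P)"
      using u_pow[OF that] r_pow[OF that] nx_pow u_pow_le by (intro integral_mono) auto
    also have "\<dots> = 2 powr (\<alpha> - 1) * (risk_lpow P \<alpha> \<theta> + \<epsilon> powr \<alpha> * Exa)"
      using r_pow[OF that] nx_pow by (simp add: riska Exa_def)
    also have "\<dots> \<le> 2 powr (\<alpha> - 1) * (S + \<epsilon> powr \<alpha> * Exa)"
      using le_S[OF that] by simp
    finally show ?thesis .
  qed
  have u_int: "(\<integral>w. u \<theta> w \<partial>P) = risk_l1 P \<theta> - \<epsilon> * Ex" if "\<theta> \<in> \<Theta>" for \<theta>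
    unfolding u_def using r_int[OF that] nx_int by (simp add: risk1 Ex_def)

  have star: "\<theta>_star \<in> \<Theta>"
    using theta_star by (simp add: is_arg_min_def)
  obtain N where N: "finite N" "eps_net \<Theta> \<epsilon> N" "card N = covering_number \<Theta> \<epsilon>"
    using minimal_eps_net[OF tot_bdd eps] .
  define K where "K = real (covering_number \<Theta> \<epsilon>)"
  have N_sub: "N \<subseteq> \<Theta>" and N_ne: "N \<noteq> {}"
    using N(2) star by (auto simp: eps_net_def)
  have K1: "1 \<le> K"
    using N(1,3) N_ne by (simp add: K_def card_gt_0_iff Suc_leI flip: N(3))
  define L where "L = ln (K / \<delta>\<^sup>2)"
  have L_split: "ln (1 / \<delta>) + ln (1 / (\<delta> / K)) = L"
    using K1 delta by (simp add: L_def ln_div ln_mult power2_eq_square)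

  have \<phi>_meas: "\<phi> \<in> borel_measurable borel"
    using phi_mono by (rule borel_measurable_mono)
  define \<psi> where "\<psi> z = - \<phi> (- z)" for z
  have \<psi>_meas: "\<psi> \<in> borel_measurable borel"
    unfolding \<psi>_def using \<phi>_meas by simp
  have \<psi>_le: "\<psi> z \<le> ln (1 + z + \<bar>z\<bar> powr \<alpha> / \<alpha>)" for z
    using phi_bounds(1)[of "- z"] by (simp add: \<psi>_def)

  \<comment> \<open>The two kinds of failure: the empirical risk is too large at \<open>\<theta>_star\<close>, or its minorant is too
    small at a point of the net. The deviation lemma is applied with \<open>\<psi>\<close> and \<open>- u \<theta>\<close> to the latter.\<close>
  define B0 where "B0 = {\<omega> \<in> space M.
      real n * (\<beta> * (\<integral>w. r \<theta>_star w \<partial>P) + \<beta> powr \<alpha> / \<alpha> * (\<integral>w. \<bar>r \<theta>_star w\<bar> powr \<alpha> \<partial>P)) + ln (1 / \<delta>)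
        \<le> (\<Sum>i=1..n. \<phi> (\<beta> * r \<theta>_star (W i \<omega>)))}"
  define B where "B \<theta> = {\<omega> \<in> space M.
      real n * (\<beta> * (\<integral>w. - u \<theta> w \<partial>P) + \<beta> powr \<alpha> / \<alpha> * (\<integral>w. \<bar>- u \<theta> w\<bar> powr \<alpha> \<partial>P)) + ln (1 / (\<delta> / K))
        \<le> (\<Sum>i=1..n. \<psi> (\<beta> * - u \<theta> (W i \<omega>)))}" for \<theta>
  have W_meas: "W i \<in> borel_measurable M" if "i \<in> {1..n}" for i
    using indep' that by (auto simp: M.indep_vars_def)
  have sum_meas: "(\<lambda>\<omega>. \<Sum>i=1..n. k (W i \<omega>)) \<in> borel_measurable M"
    if "k \<in> borel_measurable borel" for k :: "_ \<Rightarrow> real"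
    using that W_meas by (intro borel_measurable_sum) (auto intro: measurable_compose)
  have k0: "(\<lambda>w. \<phi> (\<beta> * r \<theta>_star w)) \<in> borel_measurable borel"
    using \<phi>_meas r_meas by simp
  have k1: "(\<lambda>w. \<psi> (\<beta> * - u \<theta> w)) \<in> borel_measurable borel" for \<theta>
    using \<psi>_meas u_meas by simp
  have B0_sets: "B0 \<in> M.events" and B_sets: "B \<theta> \<in> M.events" for \<theta>
    unfolding B0_def B_def using sum_meas[OF k0] sum_meas[OF k1] by simp_all
  have B0_le: "M.prob B0 \<le> \<delta>"
    unfolding B0_def
    by (rule M.influence_sum_deviation[OF indep' law' P \<phi>_meas phi_bounds(2) r_meas])
      (use r_pow[OF star] r_nonneg alpha beta delta in auto)
  have B_le: "M.prob (B \<theta>) \<le> \<delta> / K" if "\<theta> \<in> N" for \<theta>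
    unfolding B_def
    by (rule M.influence_sum_deviation[OF indep' law' P \<psi>_meas \<psi>_le])
      (use u_pow[of \<theta>] u_meas that N_sub alpha beta delta K1 in auto)

  \<comment> \<open>\<open>A\<close> refers to \<open>\<theta>_star\<close> and the net, but not to \<open>\<theta>_hat\<close>, so it is an event even if the
    selection of minimizers is not measurable.\<close>
  define A where "A = space M - (B0 \<union> (\<Union>\<theta>\<in>N. B \<theta>))"
  have bad_sets: "B0 \<union> (\<Union>\<theta>\<in>N. B \<theta>) \<in> M.events"
    using B0_sets B_sets N(1) by auto
  have A_sets: "A \<in> M.events"
    unfolding A_def using bad_sets by auto
  have "M.prob (B0 \<union> (\<Union>\<theta>\<in>N. B \<theta>)) \<le> M.prob B0 + M.prob (\<Union>\<theta>\<in>N. B \<theta>)"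
    using B0_sets B_sets N(1) by (intro measure_Un_le) auto
  also have "M.prob (\<Union>\<theta>\<in>N. B \<theta>) \<le> (\<Sum>\<theta>\<in>N. M.prob (B \<theta>))"
    using B_sets N(1) by (intro measure_UNION_le) auto
  also have "(\<Sum>\<theta>\<in>N. M.prob (B \<theta>)) \<le> (\<Sum>\<theta>\<in>N. \<delta> / K)"
    using B_le by (rule sum_mono)
  also have "(\<Sum>\<theta>\<in>N. \<delta> / K) = \<delta>"
    using K1 N(3) by (simp add: K_def)
  finally have "M.prob (B0 \<union> (\<Union>\<theta>\<in>N. B \<theta>)) \<le> 2 * \<delta>"
    using B0_le by linarith
  then have A_prob: "1 - 2 * \<delta> \<le> M.prob A"
    unfolding A_def using M.prob_compl[OF bad_sets] by simp

  define C where "C = 2 powr (\<alpha> - 1) * \<epsilon> powr \<alpha> / \<alpha> * Exa + (2 powr (\<alpha> - 1) + 1) / \<alpha> * S"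
  have bound: "risk_l1 P (\<theta>_hat \<omega>) - risk_l1 P \<theta>_star
      \<le> 2 * \<epsilon> * Ex + C * \<beta> powr (\<alpha> - 1) + 1 / (real n * \<beta>) * L" if "\<omega> \<in> A" for \<omega>
  proof -
    have \<omega>: "\<omega> \<in> space M" and good: "\<omega> \<notin> B0" "\<And>\<theta>. \<theta> \<in> N \<Longrightarrow> \<omega> \<notin> B \<theta>"
      using that by (auto simp: A_def)
    have hat: "\<theta>_hat \<omega> \<in> \<Theta>"
      and hat_min: "emp_risk \<phi> \<beta> n (\<lambda>i. X i \<omega>) (\<lambda>i. Y i \<omega>) (\<theta>_hat \<omega>)
        \<le> emp_risk \<phi> \<beta> n (\<lambda>i. X i \<omega>) (\<lambda>i. Y i \<omega>) \<theta>_star"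
      using theta_hat[OF \<omega>] star by (auto simp: is_arg_min_def not_less)
    obtain \<theta> where \<theta>: "\<theta> \<in> N" "dist (\<theta>_hat \<omega>) \<theta> \<le> \<epsilon>"
      using N(2) hat unfolding eps_net_def by blast
    then have \<theta>_in: "\<theta> \<in> \<Theta>"
      using N_sub by blast
    have nb: "0 < real n * \<beta>"
      using n beta by simp

    have "(\<Sum>i=1..n. \<phi> (\<beta> * u \<theta> (W i \<omega>))) \<le> (\<Sum>i=1..n. \<phi> (\<beta> * r (\<theta>_hat \<omega>) (W i \<omega>)))"
      using influence_sum_net_le[OF phi_mono _ \<theta>(2), where I = "{1..n}" and \<beta> = \<beta>
          and x = "\<lambda>i. X i \<omega>" and y = "\<lambda>i. Y i \<omega>"] beta
      by (simp add: u_def r_def W_def)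
    also have "\<dots> \<le> (\<Sum>i=1..n. \<phi> (\<beta> * r \<theta>_star (W i \<omega>)))"
      using hat_min nb by (simp add: emp_risk_def r_def W_def divide_le_cancel)
    also have "\<dots> < real n * (\<beta> * risk_l1 P \<theta>_star + \<beta> powr \<alpha> / \<alpha> * risk_lpow P \<alpha> \<theta>_star) + ln (1 / \<delta>)"
      using good(1) \<omega> by (simp add: B0_def risk1 riska r_nonneg not_le)
    also have "\<dots> \<le> real n * (\<beta> * risk_l1 P \<theta>_star + \<beta> powr \<alpha> / \<alpha> * S) + ln (1 / \<delta>)"
      using le_S[OF star] alpha beta by (intro add_mono mult_left_mono) auto
    finally have up: "(\<Sum>i=1..n. \<phi> (\<beta> * u \<theta> (W i \<omega>)))
      < real n * (\<beta> * risk_l1 P \<theta>_star + \<beta> powr \<alpha> / \<alpha> * S) + ln (1 / \<delta>)" .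

    have "- (\<Sum>i=1..n. \<phi> (\<beta> * u \<theta> (W i \<omega>)))
        < real n * (\<beta> * - (risk_l1 P \<theta> - \<epsilon> * Ex) + \<beta> powr \<alpha> / \<alpha> * (\<integral>w. \<bar>u \<theta> w\<bar> powr \<alpha> \<partial>P))
          + ln (1 / (\<delta> / K))"
      using good(2)[OF \<theta>(1)] \<omega>
      by (simp add: B_def \<psi>_def sum_negf u_int[OF \<theta>_in] not_le)
    also have "\<dots> \<le> real n * (\<beta> * - (risk_l1 P \<theta> - \<epsilon> * Ex)
          + \<beta> powr \<alpha> / \<alpha> * (2 powr (\<alpha> - 1) * (S + \<epsilon> powr \<alpha> * Exa))) + ln (1 / (\<delta> / K))"
      using u_pow_int[OF \<theta>_in] alpha beta by (intro add_mono mult_left_mono) auto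
    finally have "0 < real n * (\<beta> * (risk_l1 P \<theta>_star - risk_l1 P \<theta> + \<epsilon> * Ex)
        + \<beta> powr \<alpha> / \<alpha> * (S + 2 powr (\<alpha> - 1) * (S + \<epsilon> powr \<alpha> * Exa))) + L"
      using up unfolding L_split[symmetric] by (simp add: algebra_simps)
    \<comment> \<open>Adding the two estimates has eliminated the random sum; dividing by \<open>n * \<beta>\<close> isolates the
      excess risk of the net point.\<close>
    also have "S + 2 powr (\<alpha> - 1) * (S + \<epsilon> powr \<alpha> * Exa) = \<alpha> * C"
      using alpha by (simp add: C_def field_simps)
    also have "\<beta> powr \<alpha> / \<alpha> * (\<alpha> * C) = \<beta> * (C * \<beta> powr (\<alpha> - 1))"
      using alpha beta by (simp add: powr_diff)
    also have "real n * (\<beta> * (risk_l1 P \<theta>_star - risk_l1 P \<theta> + \<epsilon> * Ex) + \<beta> * (C * \<beta> powr (\<alpha> - 1))) + L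
      = real n * \<beta> * (risk_l1 P \<theta>_star - risk_l1 P \<theta> + \<epsilon> * Ex + C * \<beta> powr (\<alpha> - 1) + 1 / (real n * \<beta>) * L)"
      using n beta by (simp add: field_simps)
    finally have net: "risk_l1 P \<theta> - risk_l1 P \<theta>_star
        < \<epsilon> * Ex + C * \<beta> powr (\<alpha> - 1) + 1 / (real n * \<beta>) * L"
      using nb by (simp add: zero_less_mult_iff)

    have "risk_l1 P (\<theta>_hat \<omega>) \<le> (\<integral>w. r \<theta> w + \<epsilon> * norm (fst w) \<partial>P)"
      unfolding risk1
    proof (rule integral_mono)
      fix w :: "(real ^ 'd) \<times> real"
      show "r (\<theta>_hat \<omega>) w \<le> r \<theta> w + \<epsilon> * norm (fst w)"
        using abs_residual_diff_le[OF \<theta>(2), of "snd w" "fst w"] unfolding r_def by linarith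
    qed (use r_int[OF hat] r_int[OF \<theta>_in] nx_int in simp_all)
    also have "\<dots> = risk_l1 P \<theta> + \<epsilon> * Ex"
      using r_int[OF \<theta>_in] nx_int by (simp add: risk1 Ex_def)
    finally show ?thesis
      using net by linarith
  qed
  have first: "with_prob_at_least M (1 - 2 * \<delta>) (\<lambda>\<omega>. risk_l1 P (\<theta>_hat \<omega>) - risk_l1 P \<theta>_star
      \<le> 2 * \<epsilon> * Ex + C * \<beta> powr (\<alpha> - 1) + 1 / (real n * \<beta>) * L)"
    unfolding with_prob_at_least_def using A_sets A_prob bound by blast

  have L_pos: "0 < L"
  proof -
    have "\<delta>\<^sup>2 < 1"
      using delta by (simp add: power_less_one_iff)
    then have "1 < K / \<delta>\<^sup>2"
      using K1 delta by (simp add: less_divide_eq)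
    then show ?thesis by (simp add: L_def)
  qed
  define c where "c = 1 / real n * L"
  have c_pos: "0 < c"
    using L_pos n by (simp add: c_def)
  have second: "with_prob_at_least M (1 - 2 * \<delta>) (\<lambda>\<omega>. risk_l1 P (\<theta>_hat \<omega>) - risk_l1 P \<theta>_star
      \<le> 2 * \<epsilon> * Ex + (C + 1) * c powr ((\<alpha> - 1) / \<alpha>))" if \<beta>: "\<beta> = c powr (1 / \<alpha>)"
  proof -
    have "\<beta> powr (\<alpha> - 1) = c powr ((\<alpha> - 1) / \<alpha>)"
      using balanced_scale(1)[of \<alpha> c] alpha c_pos \<beta> by simp
    moreover have "1 / (real n * \<beta>) * L = c / \<beta>"
      by (simp add: c_def)
    then have "1 / (real n * \<beta>) * L = c powr ((\<alpha> - 1) / \<alpha>)"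
      using balanced_scale(2)[of \<alpha> c] alpha c_pos \<beta> by simp
    ultimately show ?thesis
      using first by (simp add: algebra_simps)
  qed
  show ?thesis
    using first second unfolding Ex_M Exa_M c_def C_def S_def L_def K_def by blast
qed

end
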